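(* Let $1\leq p<\infty$ and $\alpha>-1$. Then a nonzero bounded linear operator on the weighted Bergman space $A^p_\alpha$ is almost multiplicative if and only if it is a composition operator.
   Context: $\mathbb{D}$ is the open unit disc in $\mathbb{C}$ and $dA=\frac1\pi\,dx\,dy$ is normalized area measure on $\mathbb{D}$. $A^p_\alpha$ is the Banach space of analytic functions $f$ on $\mathbb{D}$ with $\|f\|_{A^p_\alpha}^p=\int_{\mathbb{D}}|f(z)|^p(\alpha+1)(1-|z|^2)^\alpha\,dA<\infty$. A bounded linear operator $T$ on a space $\mathcal{A}$ of analytic functions on $\mathbb{D}$ is almost multiplicative if $T(fg)=T(f)T(g)$ whenever $f,g,fg\in\mathcal{A}$ (pointwise product). $T$ is a composition operator on $\mathcal{A}$ if there is an analytic map $\varphi:\mathbb{D}\to\mathbb{D}$ such that $Tf=f\circ\varphi$ for all $f\in\mathcal{A}$. *)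

theory Defs
  imports "HOL-Complex_Analysis.Complex_Analysis"
begin

abbreviation unit_disc :: "complex set" where
  "unit_disc \<equiv> ball 0 1"

definition disc_area :: "complex measure" where
  "disc_area = scale_measure (ennreal (1 / pi)) (restrict_space lborel unit_disc)"

definition bergman_integral :: "real \<Rightarrow> real \<Rightarrow> (complex \<Rightarrow> complex) \<Rightarrow> ennreal" where
  "bergman_integral p \<alpha> f =
     (\<integral>\<^sup>+ z. ennreal (cmod (f z) powr p * ((\<alpha> + 1) * (1 - (cmod z)\<^sup>2) powr \<alpha>)) \<partial>disc_area)"

text \<open>A function on the disc is represented by its extension by 0 to the whole plane.
  Equality in the space is then equality of HOL functions, and sums, scalar multiples and
  products are the pointwise ones.\<close>

definition bergman_space :: "real \<Rightarrow> real \<Rightarrow> (complex \<Rightarrow> complex) set" where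
  "bergman_space p \<alpha> =
     {f. f holomorphic_on unit_disc \<and> (\<forall>z. z \<notin> unit_disc \<longrightarrow> f z = 0)
         \<and> bergman_integral p \<alpha> f < \<infinity>}"

definition bergman_norm :: "real \<Rightarrow> real \<Rightarrow> (complex \<Rightarrow> complex) \<Rightarrow> real" where
  "bergman_norm p \<alpha> f = enn2real (bergman_integral p \<alpha> f) powr (1 / p)"

text \<open>Operators on a space \<open>\<A>\<close> of functions are total HOL functions of which only the values
  on \<open>\<A>\<close> matter.\<close>

definition bounded_linear_operator_on ::
  "(complex \<Rightarrow> complex) set \<Rightarrow> ((complex \<Rightarrow> complex) \<Rightarrow> real)
     \<Rightarrow> ((complex \<Rightarrow> complex) \<Rightarrow> (complex \<Rightarrow> complex)) \<Rightarrow> bool" where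
  "bounded_linear_operator_on \<A> N T \<longleftrightarrow>
     (\<forall>f\<in>\<A>. T f \<in> \<A>) \<and>
     (\<forall>f\<in>\<A>. \<forall>g\<in>\<A>. T (\<lambda>z. f z + g z) = (\<lambda>z. T f z + T g z)) \<and>
     (\<forall>c. \<forall>f\<in>\<A>. T (\<lambda>z. c * f z) = (\<lambda>z. c * T f z)) \<and>
     (\<exists>C. \<forall>f\<in>\<A>. N (T f) \<le> C * N f)"

definition nonzero_operator_on ::
  "(complex \<Rightarrow> complex) set \<Rightarrow> ((complex \<Rightarrow> complex) \<Rightarrow> (complex \<Rightarrow> complex)) \<Rightarrow> bool" where
  "nonzero_operator_on \<A> T \<longleftrightarrow> (\<exists>f\<in>\<A>. T f \<noteq> (\<lambda>z. 0))"

definition almost_multiplicative_on ::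
  "(complex \<Rightarrow> complex) set \<Rightarrow> ((complex \<Rightarrow> complex) \<Rightarrow> (complex \<Rightarrow> complex)) \<Rightarrow> bool" where
  "almost_multiplicative_on \<A> T \<longleftrightarrow>
     (\<forall>f\<in>\<A>. \<forall>g\<in>\<A>. (\<lambda>z. f z * g z) \<in> \<A> \<longrightarrow>
        T (\<lambda>z. f z * g z) = (\<lambda>z. T f z * T g z))"

text \<open>The composite is only compared with \<open>T f\<close> on the disc: the values of \<open>\<phi>\<close> outside
  are irrelevant.\<close>

definition composition_operator_on ::
  "(complex \<Rightarrow> complex) set \<Rightarrow> ((complex \<Rightarrow> complex) \<Rightarrow> (complex \<Rightarrow> complex)) \<Rightarrow> bool" where
  "composition_operator_on \<A> T \<longleftrightarrow>
     (\<exists>\<phi>. \<phi> holomorphic_on unit_disc \<and> \<phi> ` unit_disc \<subseteq> unit_disc \<and>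
        (\<forall>f\<in>\<A>. \<forall>z\<in>unit_disc. T f z = f (\<phi> z)))"

end

theory Submission
  imports Defs
begin

text \<open>The function \<open>T 1\<close> is idempotent and analytic, hence constant, and it is 1 because
  \<open>T \<noteq> 0\<close>. Put \<open>\<phi> = T z\<close>, so that \<open>T z\<^sup>n = \<phi>\<^sup>n\<close>. Since \<open>z\<^sup>n\<close> tends to 0 in norm, \<open>\<bar>\<phi>\<bar> \<ge> 1\<close>
  cannot hold on a nonempty open set, and the open mapping theorem then excludes it at every
  single point. For \<open>a = \<phi> w\<close> every \<open>f\<close> in the space factors as \<open>f = f a + (z - a) g\<close> with \<open>g\<close> in the
  space; applying \<open>T\<close> and evaluating at \<open>w\<close> gives \<open>T f w = f (\<phi> w)\<close>, with no appeal to the density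
  of polynomials.\<close>

section \<open>Normalized area measure and the radial weight\<close>

lemma space_disc_area [simp]: "space disc_area = unit_disc"
  by (simp add: disc_area_def space_scale_measure space_restrict_space)

lemma sets_disc_area [measurable_cong]:
  "sets disc_area = sets (restrict_space borel unit_disc)"
  by (simp add: disc_area_def sets_restrict_space)

lemma emeasure_disc_area:
  assumes "A \<subseteq> unit_disc"
  shows "emeasure disc_area A = ennreal (1 / pi) * emeasure lborel A"
  using assms by (simp add: disc_area_def emeasure_restrict_space)

lemma borel_measurable_disc_area:
  assumes "continuous_on unit_disc f"
  shows "f \<in> borel_measurable disc_area"
  using borel_measurable_continuous_on_restrict[OF assms]
  by (simp add: measurable_cong_sets[OF sets_disc_area refl])

lemma emeasure_disc_area_ball:
  assumes "0 \<le> r" "r \<le> 1"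
  shows "emeasure disc_area (ball 0 r) = ennreal (r\<^sup>2)"
proof -
  have "ball 0 r \<subseteq> unit_disc" using assms by auto
  then have "emeasure disc_area (ball 0 r) = ennreal (1 / pi) * ennreal (pi * r\<^sup>2)"
    using assms by (simp add: emeasure_disc_area emeasure_ball unit_ball_vol_2)
  also have "\<dots> = ennreal (r\<^sup>2)"
    by (simp flip: ennreal_mult)
  finally show ?thesis .
qed

text \<open>Used in place of polar coordinates.\<close>

lemma distr_disc_area:
  "distr disc_area borel (\<lambda>z. 1 - (cmod z)\<^sup>2) = density lborel (indicator {0..1})"
proof (rule measure_eqI_lessThan)
  have m [measurable]: "(\<lambda>z. 1 - (cmod z)\<^sup>2) \<in> borel_measurable disc_area"
    by (intro borel_measurable_disc_area continuous_intros)
  \<comment> \<open>Finite values on all half-lines \<open>{x<..}\<close> determine a Borel measure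
    on the line. The preimage of such a half-line is a disc about 0 whose squared radius is
    \<open>1 - x\<close> clamped to \<open>[0, 1]\<close>: the whole unit disc for negative
    \<open>x\<close>, empty for \<open>x \<ge> 1\<close>.\<close>
  have eq: "emeasure (distr disc_area borel (\<lambda>z. 1 - (cmod z)\<^sup>2)) {x<..} = ennreal (min 1 (max 0 (1 - x)))" for x
  proof -
    have "emeasure (distr disc_area borel (\<lambda>z. 1 - (cmod z)\<^sup>2)) {x<..} =
        emeasure disc_area {z \<in> unit_disc. x < 1 - (cmod z)\<^sup>2}"
      by (subst emeasure_distr) (auto intro!: arg_cong[where f = "emeasure disc_area"])
    also have "{z \<in> unit_disc. x < 1 - (cmod z)\<^sup>2} = ball 0 (sqrt (min 1 (max 0 (1 - x))))"
    proof -
      have "cmod z < 1 \<and> x < 1 - (cmod z)\<^sup>2 \<longleftrightarrow> (cmod z)\<^sup>2 < min 1 (max 0 (1 - x))" for z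
      proof -
        have "cmod z < 1 \<longleftrightarrow> (cmod z)\<^sup>2 < 1"
          by (simp add: power_less_one_iff)
        moreover have "0 \<le> (cmod z)\<^sup>2" by simp
        ultimately show ?thesis by (smt (verit))
      qed
      moreover have "cmod z < sqrt y \<longleftrightarrow> (cmod z)\<^sup>2 < y" for z y
        by (metis norm_ge_zero real_less_rsqrt real_sqrt_less_iff real_sqrt_abs abs_norm_cancel)
      ultimately show ?thesis by auto
    qed
    finally show ?thesis
      by (simp add: emeasure_disc_area_ball)
  qed
  show "emeasure (distr disc_area borel (\<lambda>z. 1 - (cmod z)\<^sup>2)) {x<..} < \<infinity>" for x
    by (simp add: eq)
  show "emeasure (distr disc_area borel (\<lambda>z. 1 - (cmod z)\<^sup>2)) {x<..} =
      emeasure (density lborel (indicator {0..1})) {x<..}" for x :: real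
  proof -
    have "emeasure (density lborel (indicator {0..1})) {x<..} = emeasure lborel ({0..1} \<inter> {x<..})"
      by (simp add: emeasure_density flip: indicator_inter_arith)
    also have "{0..1} \<inter> {x<..} = (if x < 0 then {0..1} else {x<..1})"
      by auto
    also have "emeasure lborel \<dots> = ennreal (min 1 (max 0 (1 - x)))"
      by (cases "x \<le> 1") auto
    finally show ?thesis by (simp add: eq)
  qed
qed auto

text \<open>The substitution \<open>t = 1 - (cmod z)\<^sup>2\<close> turns the integral into that of
  \<open>(\<alpha> + 1) * t powr \<alpha>\<close> over \<open>[0, 1]\<close>, which equals 1.
  Convergence at \<open>t = 0\<close> is where \<open>\<alpha> > -1\<close> enters.\<close>

lemma nn_integral_weight_finite:
  assumes "-1 < \<alpha>"
  shows "(\<integral>\<^sup>+ z. ennreal ((\<alpha> + 1) * (1 - (cmod z)\<^sup>2) powr \<alpha>) \<partial>disc_area) < \<infinity>"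
proof -
  have m [measurable]: "(\<lambda>z. 1 - (cmod z)\<^sup>2) \<in> borel_measurable disc_area"
    by (intro borel_measurable_disc_area continuous_intros)
  have "(\<integral>\<^sup>+ z. ennreal ((\<alpha> + 1) * (1 - (cmod z)\<^sup>2) powr \<alpha>) \<partial>disc_area) =
      (\<integral>\<^sup>+ t. ennreal ((\<alpha> + 1) * t powr \<alpha>) \<partial>distr disc_area borel (\<lambda>z. 1 - (cmod z)\<^sup>2))"
    by (subst nn_integral_distr) auto
  also have "\<dots> = (\<integral>\<^sup>+ t. ennreal ((\<alpha> + 1) * t powr \<alpha>) * indicator {0..1} t \<partial>lborel)"
    by (simp add: distr_disc_area nn_integral_density mult.commute)
  also have "\<dots> = ennreal ((\<alpha> + 1) * (1 powr (\<alpha> + 1) / (\<alpha> + 1)))"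
    using assms
    by (intro nn_integral_has_integral_lebesgue' has_integral_mult_right has_integral_powr_from_0) auto
  finally show ?thesis by simp
qed

section \<open>Monotonicity of the norm, membership by comparison, and division by
  \<open>z - a\<close>\<close>

lemma borel_measurable_bergman_integrand:
  assumes "continuous_on unit_disc f"
  shows "(\<lambda>z. ennreal (cmod (f z) powr p * ((\<alpha> + 1) * (1 - (cmod z)\<^sup>2) powr \<alpha>)))
    \<in> borel_measurable disc_area"
proof -
  have [measurable]: "f \<in> borel_measurable disc_area"
    "(\<lambda>z. 1 - (cmod z)\<^sup>2) \<in> borel_measurable disc_area"
    using assms by (auto intro!: borel_measurable_disc_area continuous_intros)
  show ?thesis by measurable
qed

lemma bergman_integral_mono:
  assumes "\<And>z. z \<in> unit_disc \<Longrightarrow> cmod (f z) \<le> cmod (g z)" "0 \<le> p" "-1 < \<alpha>"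
  shows "bergman_integral p \<alpha> f \<le> bergman_integral p \<alpha> g"
  unfolding bergman_integral_def using assms
  by (intro nn_integral_mono ennreal_leI mult_right_mono powr_mono2) auto

text \<open>The larger integral has to be finite because \<open>enn2real\<close> sends infinity to
  0. Neither function has to be analytic, so indicators can be compared with members of the
  space.\<close>

lemma bergman_norm_mono:
  assumes "\<And>z. z \<in> unit_disc \<Longrightarrow> cmod (f z) \<le> cmod (g z)" "0 \<le> p" "-1 < \<alpha>"
    and "bergman_integral p \<alpha> g < \<infinity>"
  shows "bergman_norm p \<alpha> f \<le> bergman_norm p \<alpha> g"
  unfolding bergman_norm_def using bergman_integral_mono[OF assms(1-3)] assms
  by (intro powr_mono2 enn2real_mono) auto

text \<open>Comparison test behind the later membership proofs. The constant \<open>M\<close> is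
  harmless because the weight has finite integral.\<close>

lemma bergman_space_dominated:
  assumes f: "f \<in> bergman_space p \<alpha>" and p: "0 \<le> p" and \<alpha>: "-1 < \<alpha>" and c: "0 \<le> c" "0 \<le> M"
    and h: "h holomorphic_on unit_disc" "\<And>z. z \<notin> unit_disc \<Longrightarrow> h z = 0"
    and le: "\<And>z. z \<in> unit_disc \<Longrightarrow> cmod (h z) \<le> c * cmod (f z) + M"
  shows "h \<in> bergman_space p \<alpha>"
proof -
  let ?w = "\<lambda>z. (\<alpha> + 1) * (1 - (cmod z)\<^sup>2) powr \<alpha>"
  have w0: "0 \<le> ?w z" for z
    using \<alpha> by auto
  \<comment> \<open>A sum is at most twice its larger term; splitting by which term is larger gives
    the bound on \<open>p\<close>-th powers and explains the factors 2.\<close>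
  have pw: "cmod (h z) powr p \<le> (2 * c) powr p * cmod (f z) powr p + (2 * M) powr p"
    if "z \<in> unit_disc" for z
  proof (cases "c * cmod (f z) \<le> M")
    case True
    then have "cmod (h z) powr p \<le> (2 * M) powr p"
      using le[OF that] p by (intro powr_mono2) auto
    then show ?thesis by (simp add: add_increasing)
  next
    case False
    then have "cmod (h z) powr p \<le> (2 * c * cmod (f z)) powr p"
      using le[OF that] p by (intro powr_mono2) auto
    then show ?thesis using c by (simp add: powr_mult add_increasing2)
  qed
  have cf: "continuous_on unit_disc f"
    using f by (auto simp: bergman_space_def holomorphic_on_imp_continuous_on)
  \<comment> \<open>For the constant function 1 the Bergman integrand is the weight itself.\<close>
  have [measurable]: "(\<lambda>z. ennreal (cmod (f z) powr p * ?w z)) \<in> borel_measurable disc_area"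
    "(\<lambda>z. ennreal (?w z)) \<in> borel_measurable disc_area"
    using borel_measurable_bergman_integrand[OF cf, of p \<alpha>]
      borel_measurable_bergman_integrand[of "\<lambda>_. 1" p \<alpha>] by auto
  have "bergman_integral p \<alpha> h \<le>
      (\<integral>\<^sup>+ z. ennreal ((2 * c) powr p) * ennreal (cmod (f z) powr p * ?w z)
        + ennreal ((2 * M) powr p) * ennreal (?w z) \<partial>disc_area)"
    unfolding bergman_integral_def
  proof (rule nn_integral_mono)
    fix z assume "z \<in> space disc_area"
    then have "cmod (h z) powr p * ?w z \<le> (2 * c) powr p * (cmod (f z) powr p * ?w z) + (2 * M) powr p * ?w z"
      using mult_right_mono[OF pw w0, of z z] by (simp add: algebra_simps)
    then have "ennreal (cmod (h z) powr p * ?w z) \<le>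
        ennreal ((2 * c) powr p * (cmod (f z) powr p * ?w z) + (2 * M) powr p * ?w z)"
      by (rule ennreal_leI)
    also have "\<dots> = ennreal ((2 * c) powr p) * ennreal (cmod (f z) powr p * ?w z)
        + ennreal ((2 * M) powr p) * ennreal (?w z)"
      using w0[of z] by (simp only: ennreal_plus ennreal_mult powr_ge_zero mult_nonneg_nonneg)
    finally show "ennreal (cmod (h z) powr p * ?w z) \<le> \<dots>" .
  qed
  also have "\<dots> = ennreal ((2 * c) powr p) * bergman_integral p \<alpha> f
      + ennreal ((2 * M) powr p) * (\<integral>\<^sup>+ z. ennreal (?w z) \<partial>disc_area)"
    unfolding bergman_integral_def by (subst nn_integral_add) (auto simp: nn_integral_cmult)
  also have "\<dots> < \<infinity>"
    using f nn_integral_weight_finite[OF \<alpha>]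
    by (simp add: bergman_space_def ennreal_mult_less_top)
  finally show ?thesis
    using h by (auto simp: bergman_space_def)
qed

lemma bergman_space_bounded:
  assumes "1 \<le> p" "-1 < \<alpha>" "h holomorphic_on unit_disc" "\<And>z. z \<notin> unit_disc \<Longrightarrow> h z = 0"
    and "\<And>z. z \<in> unit_disc \<Longrightarrow> cmod (h z) \<le> M" "0 \<le> M"
  shows "h \<in> bergman_space p \<alpha>"
proof (rule bergman_space_dominated)
  show "(\<lambda>_. 0) \<in> bergman_space p \<alpha>"
    by (simp add: bergman_space_def bergman_integral_def)
qed (use assms in \<open>auto intro: order_trans\<close>)

text \<open>The difference quotient of \<open>f\<close> at \<open>a\<close> stays in the space: near
  \<open>a\<close> it is bounded by compactness, and elsewhere its denominator is bounded away from
  0, so it is controlled by \<open>f\<close> and a constant.\<close>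

lemma bergman_space_factor:
  assumes f: "f \<in> bergman_space p \<alpha>" and p: "1 \<le> p" and \<alpha>: "-1 < \<alpha>" and a: "a \<in> unit_disc"
  obtains g where "g \<in> bergman_space p \<alpha>"
    "\<And>z. z \<in> unit_disc \<Longrightarrow> f z = f a + (z - a) * g z"
proof
  \<comment> \<open>The derivative fills the removable singularity at \<open>a\<close>. The cut-off
    in \<open>g\<close> is there because members of the space vanish outside the disc.\<close>
  define d where "d = (\<lambda>z. if z = a then deriv f a else (f z - f a) / (z - a))"
  define g where "g = (\<lambda>z. if z \<in> unit_disc then d z else 0)"
  have fh: "f holomorphic_on unit_disc" using f by (simp add: bergman_space_def)
  have dh: "d holomorphic_on unit_disc"
    unfolding d_def using fh by (intro pole_lemma_open) auto
  obtain r where r: "0 < r" "cball a r \<subseteq> unit_disc"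
    using a open_contains_cball_eq[OF open_ball] by blast
  have "compact (d ` cball a r)"
    using dh r by (intro compact_continuous_image)
      (auto intro: continuous_on_subset holomorphic_on_imp_continuous_on)
  then obtain B where B: "\<And>z. z \<in> cball a r \<Longrightarrow> cmod (d z) \<le> B"
    by (meson bounded_iff compact_imp_bounded imageI)
  then have "0 \<le> B"
    using norm_ge_zero order_trans r(1) by (metis centre_in_cball less_imp_le)
  \<comment> \<open>\<open>B\<close> bounds the quotient on \<open>cball a r\<close>; off that ball
    \<open>cmod (z - a) \<ge> r\<close> contributes the terms with \<open>1 / r\<close>. Adding both
    bounds covers the two cases at once.\<close>
  show "g \<in> bergman_space p \<alpha>"
  proof (rule bergman_space_dominated[OF f, of "1 / r" "B + cmod (f a) / r"])
    show "g holomorphic_on unit_disc"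
      using dh by (rule holomorphic_transform) (simp add: g_def)
    fix z assume z: "z \<in> unit_disc"
    show "cmod (g z) \<le> 1 / r * cmod (f z) + (B + cmod (f a) / r)"
    proof (cases "z \<in> cball a r")
      case True
      then have "cmod (g z) \<le> B" using B z by (simp add: g_def)
      moreover have "0 \<le> 1 / r * cmod (f z)" "0 \<le> cmod (f a) / r" using r by auto
      ultimately show ?thesis by linarith
    next
      case False
      then have far: "r \<le> cmod (z - a)" by (simp add: dist_norm norm_minus_commute)
      then have "z \<noteq> a" using r by auto
      then have "cmod (g z) = cmod (f z - f a) / cmod (z - a)"
        using z by (simp add: g_def d_def norm_divide)
      also have "\<dots> \<le> (cmod (f z) + cmod (f a)) / r"
        using r far by (intro frac_le norm_triangle_ineq4) auto
      finally show ?thesis using \<open>0 \<le> B\<close> by (simp add: add_divide_distrib)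
    qed
  qed (use p \<alpha> r \<open>0 \<le> B\<close> in \<open>auto simp: g_def\<close>)
  show "f z = f a + (z - a) * g z" if "z \<in> unit_disc" for z
    using that by (simp add: g_def d_def)
qed

section \<open>Test functions: monomials and indicators of open sets\<close>

text \<open>The cut-off makes these members of the space under the convention of extension by 0. In
  particular \<open>disc_monom 0\<close> is the constant 1 of the space.\<close>

definition disc_monom :: "nat \<Rightarrow> complex \<Rightarrow> complex" where
  "disc_monom n = (\<lambda>z. if z \<in> unit_disc then z ^ n else 0)"

lemma disc_monom_holomorphic: "disc_monom n holomorphic_on unit_disc"
  by (rule holomorphic_transform[of "\<lambda>z. z ^ n"]) (auto simp: disc_monom_def intro!: holomorphic_intros)

lemma norm_disc_monom_le: "cmod (disc_monom n z) \<le> 1"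
  by (simp add: disc_monom_def norm_power power_le_one)

lemma disc_monom_in_bergman_space:
  assumes "1 \<le> p" "-1 < \<alpha>"
  shows "disc_monom n \<in> bergman_space p \<alpha>"
  using assms disc_monom_holomorphic
  by (rule bergman_space_bounded[where M = 1]) (auto simp: norm_disc_monom_le, simp add: disc_monom_def)

text \<open>Dominated convergence with the weight as majorant: \<open>z ^ n\<close> tends to 0 at
  every point of the open disc.\<close>

lemma bergman_norm_disc_monom_tendsto_0:
  assumes "1 \<le> p" "-1 < \<alpha>"
  shows "(\<lambda>n. bergman_norm p \<alpha> (disc_monom n)) \<longlonglongrightarrow> 0"
proof -
  let ?w = "\<lambda>z. (\<alpha> + 1) * (1 - (cmod z)\<^sup>2) powr \<alpha>"
  have "(\<lambda>n. bergman_integral p \<alpha> (disc_monom n)) \<longlonglongrightarrow> (\<integral>\<^sup>+ z. 0 \<partial>disc_area)"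
    unfolding bergman_integral_def
  proof (rule nn_integral_dominated_convergence)
    show "(\<lambda>z. ennreal (cmod (disc_monom n z) powr p * ?w z)) \<in> borel_measurable disc_area" for n
      by (intro borel_measurable_bergman_integrand holomorphic_on_imp_continuous_on disc_monom_holomorphic)
    show "(\<lambda>z. ennreal (?w z)) \<in> borel_measurable disc_area"
      using borel_measurable_bergman_integrand[of "\<lambda>_. 1" p \<alpha>] by auto
    show "(\<integral>\<^sup>+ z. ennreal (?w z) \<partial>disc_area) < \<infinity>"
      by (rule nn_integral_weight_finite[OF assms(2)])
    have "cmod (disc_monom n z) powr p \<le> 1" for n z
      using norm_disc_monom_le[of n z] assms by (intro powr_le1) auto
    then have "cmod (disc_monom n z) powr p * ?w z \<le> ?w z" for n z
      using assms by (intro mult_left_le_one_le) auto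
    then show "AE z in disc_area. ennreal (cmod (disc_monom n z) powr p * ?w z) \<le> ennreal (?w z)" for n
      by (intro AE_I2 ennreal_leI)
    have "(\<lambda>n. ennreal (cmod (disc_monom n z) powr p * ?w z)) \<longlonglongrightarrow> 0" if "z \<in> unit_disc" for z
    proof -
      have "(\<lambda>n. cmod (disc_monom n z)) \<longlonglongrightarrow> 0"
        using that by (simp add: disc_monom_def norm_power LIMSEQ_power_zero)
      \<comment> \<open>Passing to the limit under \<open>powr\<close> at base 0 relies on a
        positive exponent, here \<open>p\<close> and at the end \<open>1 / p\<close>.\<close>
      then have "(\<lambda>n. cmod (disc_monom n z) powr p) \<longlonglongrightarrow> 0 powr p"
        using assms by (intro tendsto_powr') auto
      then have "(\<lambda>n. cmod (disc_monom n z) powr p * ?w z) \<longlonglongrightarrow> 0"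
        by (auto intro: tendsto_mult_left_zero)
      then show ?thesis
        using tendsto_ennrealI by fastforce
    qed
    then show "AE z in disc_area. (\<lambda>n. ennreal (cmod (disc_monom n z) powr p * ?w z)) \<longlonglongrightarrow> 0"
      by (intro AE_I2) simp
  qed auto
  then have "(\<lambda>n. enn2real (bergman_integral p \<alpha> (disc_monom n))) \<longlonglongrightarrow> 0"
    using tendsto_enn2real[of _ 0] by simp
  then have "(\<lambda>n. enn2real (bergman_integral p \<alpha> (disc_monom n)) powr (1 / p)) \<longlonglongrightarrow> 0 powr (1 / p)"
    using assms by (intro tendsto_powr') auto
  then show ?thesis
    by (simp add: bergman_norm_def)
qed

text \<open>The weight is strictly positive on the disc, so a vanishing integral would make
  \<open>U\<close> a Lebesgue null set, although \<open>U\<close> contains a ball.\<close>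

lemma bergman_norm_indicator_pos:
  assumes U: "open U" "U \<noteq> {}" "U \<subseteq> unit_disc" and "1 \<le> p" "-1 < \<alpha>"
  shows "0 < bergman_norm p \<alpha> (indicator U)"
proof -
  let ?w = "\<lambda>z. (\<alpha> + 1) * (1 - (cmod z)\<^sup>2) powr \<alpha>"
  have wpos: "0 < ?w z" if "z \<in> unit_disc" for z
    using that assms by (auto simp: power_less_one_iff abs_square_eq_1)
  have [measurable]: "(\<lambda>z. ennreal (?w z)) \<in> borel_measurable disc_area"
    using borel_measurable_bergman_integrand[of "\<lambda>_. 1" p \<alpha>] by auto
  have Us [measurable]: "U \<in> sets disc_area"
    using U by (auto simp: sets_disc_area sets_restrict_space image_iff)
  \<comment> \<open>The \<open>p\<close>-th power of an indicator is the same indicator, as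
    \<open>0 powr p = 0\<close>.\<close>
  have eq: "bergman_integral p \<alpha> (indicator U) = (\<integral>\<^sup>+ z. ennreal (?w z) * indicator U z \<partial>disc_area)"
    unfolding bergman_integral_def by (intro nn_integral_cong) (auto simp: indicator_def)
  have "bergman_integral p \<alpha> (indicator U) \<noteq> 0"
  proof
    assume "bergman_integral p \<alpha> (indicator U) = 0"
    then have "AE z in disc_area. ennreal (?w z) * indicator U z = 0"
      by (simp add: eq nn_integral_0_iff_AE)
    then have "AE z in disc_area. z \<notin> U"
    proof eventually_elim
      case (elim z)
      show ?case
      proof
        assume "z \<in> U"
        then have "0 < ?w z" using wpos U(3) by blast
        with elim \<open>z \<in> U\<close> show False by (simp add: ennreal_eq_0_iff)
      qed
    qed
    moreover have "{z \<in> space disc_area. \<not> z \<notin> U} = U"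
      using U(3) by auto
    ultimately have "emeasure disc_area U = 0"
      using AE_iff_measurable[OF Us, of "\<lambda>z. z \<notin> U"] by simp
    then have null: "emeasure lborel U = 0"
      using U pi_gt_zero by (simp add: emeasure_disc_area ennreal_eq_0_iff not_le[symmetric])
    obtain x r where r: "0 < r" "ball x r \<subseteq> U"
      using U by (meson all_not_in_conv openE)
    then have "emeasure lborel (ball x r) \<le> emeasure lborel U"
      using U by (intro emeasure_mono) auto
    then show False
      using r null pi_gt_zero by (simp add: emeasure_ball unit_ball_vol_2 ennreal_eq_0_iff mult_le_0_iff not_le[symmetric])
  qed
  \<comment> \<open>An infinite integral would also give norm 0 through \<open>enn2real\<close>, so
    finiteness has to be checked.\<close>
  moreover have "bergman_integral p \<alpha> (indicator U) < \<infinity>"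
  proof -
    have "bergman_integral p \<alpha> (indicator U) \<le> (\<integral>\<^sup>+ z. ennreal (?w z) \<partial>disc_area)"
      unfolding eq by (intro nn_integral_mono) (auto simp: indicator_def)
    also have "\<dots> < \<infinity>"
      by (rule nn_integral_weight_finite[OF assms(5)])
    finally show ?thesis .
  qed
  ultimately show ?thesis
    by (simp add: bergman_norm_def enn2real_eq_0_iff less_top[symmetric])
qed

section \<open>Almost multiplicative operators: the unit, the symbol, and composition\<close>

locale bergman_multiplicative =
  fixes p \<alpha> :: real and T :: "(complex \<Rightarrow> complex) \<Rightarrow> (complex \<Rightarrow> complex)"
  assumes p: "1 \<le> p" and \<alpha>: "-1 < \<alpha>"
    and operator: "bounded_linear_operator_on (bergman_space p \<alpha>) (bergman_norm p \<alpha>) T"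
    and nonzero: "nonzero_operator_on (bergman_space p \<alpha>) T"
    and multiplicative: "almost_multiplicative_on (bergman_space p \<alpha>) T"
begin

abbreviation A where "A \<equiv> bergman_space p \<alpha>"

lemma T_in: "f \<in> A \<Longrightarrow> T f \<in> A"
  and T_add: "f \<in> A \<Longrightarrow> g \<in> A \<Longrightarrow> T (\<lambda>z. f z + g z) = (\<lambda>z. T f z + T g z)"
  and T_scale: "f \<in> A \<Longrightarrow> T (\<lambda>z. c * f z) = (\<lambda>z. c * T f z)"
  using operator unfolding bounded_linear_operator_on_def by blast+

lemma T_mult: "f \<in> A \<Longrightarrow> g \<in> A \<Longrightarrow> (\<lambda>z. f z * g z) \<in> A \<Longrightarrow> T (\<lambda>z. f z * g z) = (\<lambda>z. T f z * T g z)"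
  using multiplicative unfolding almost_multiplicative_on_def by blast

lemma monom_in: "disc_monom n \<in> A"
  using p \<alpha> by (rule disc_monom_in_bergman_space)

lemma scale_in:
  assumes f: "f \<in> A"
  shows "(\<lambda>z. c * f z) \<in> A"
proof (rule bergman_space_dominated[OF f])
  show "(\<lambda>z. c * f z) holomorphic_on unit_disc"
    using f by (intro holomorphic_on_mult holomorphic_on_const) (simp add: bergman_space_def)
  show "c * f z = 0" if "z \<notin> unit_disc" for z
    using f that by (simp add: bergman_space_def)
  show "cmod (c * f z) \<le> cmod c * cmod (f z) + 0" for z
    by (simp add: norm_mult)
qed (use p \<alpha> in auto)

lemma T_one: "z \<in> unit_disc \<Longrightarrow> T (disc_monom 0) z = 1"
proof -
  let ?e = "disc_monom 0"
  have absorb: "(\<lambda>z. f z * ?e z) = f" if "f \<in> A" for f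
  proof
    fix z show "f z * ?e z = f z"
      using that by (cases "z \<in> unit_disc") (simp_all add: bergman_space_def disc_monom_def)
  qed
  \<comment> \<open>Taking \<open>f = ?e\<close> makes \<open>T ?e\<close> idempotent, so its values
    are 0 or 1, and continuity on the connected disc makes it constant. Taking an \<open>f\<close>
    with \<open>T f \<noteq> 0\<close> then rules out the constant 0.\<close>
  have e: "T f z = T f z * T ?e z" if "f \<in> A" for f z
    using fun_cong[OF T_mult[OF that monom_in[of 0]], of z] that by (simp only: absorb[OF that])
  have "T ?e holomorphic_on unit_disc"
    using T_in[OF monom_in] by (simp add: bergman_space_def)
  moreover have "T ?e ` unit_disc \<subseteq> {0, 1}"
    using e[OF monom_in[of 0]] by (metis image_subsetI insertCI mult_cancel_left1)
  ultimately have "T ?e constant_on unit_disc"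
    by (intro continuous_finite_range_constant)
      (auto intro: holomorphic_on_imp_continuous_on finite_subset)
  then obtain c where c: "\<And>z. z \<in> unit_disc \<Longrightarrow> T ?e z = c"
    by (auto simp: constant_on_def)
  obtain f w where f: "f \<in> A" "T f w \<noteq> 0"
    using nonzero unfolding nonzero_operator_on_def by blast
  moreover have "w \<in> unit_disc"
    using T_in[OF f(1)] f(2) by (auto simp: bergman_space_def)
  ultimately have "c = 1"
    using e[OF f(1), of w] by (simp only: c mult_cancel_left1) simp
  then show "z \<in> unit_disc \<Longrightarrow> T ?e z = 1" using c by simp
qed

text \<open>A composition operator sends the coordinate function to its symbol, so on the disc this
  is the only candidate.\<close>

abbreviation \<phi> where "\<phi> \<equiv> T (disc_monom 1)"

lemma symbol_holomorphic: "\<phi> holomorphic_on unit_disc"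
  using T_in[OF monom_in] by (simp add: bergman_space_def)

lemma T_monom: "z \<in> unit_disc \<Longrightarrow> T (disc_monom n) z = \<phi> z ^ n"
proof (induction n)
  case 0
  then show ?case by (simp add: T_one)
next
  case (Suc n)
  have "disc_monom (Suc n) = (\<lambda>z. disc_monom 1 z * disc_monom n z)"
    by (auto simp: disc_monom_def)
  then have "T (disc_monom (Suc n)) = (\<lambda>z. \<phi> z * T (disc_monom n) z)"
    using T_mult[OF monom_in[of 1] monom_in[of n]] monom_in[of "Suc n"] by simp
  then show ?case using Suc by simp
qed

text \<open>If \<open>\<bar>\<phi>\<bar> \<ge> 1\<close> on \<open>U\<close>, then \<open>\<phi>\<^sup>n = T z\<^sup>n\<close> dominates the indicator of \<open>U\<close>, while
  the norm of \<open>z\<^sup>n\<close> tends to 0.\<close>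

lemma not_expanding_on_open:
  assumes U: "open U" "U \<noteq> {}" "U \<subseteq> unit_disc"
  shows "\<exists>z\<in>U. cmod (\<phi> z) < 1"
proof (rule ccontr)
  assume "\<not> (\<exists>z\<in>U. cmod (\<phi> z) < 1)"
  then have ge: "1 \<le> cmod (\<phi> z)" if "z \<in> U" for z
    using that by force
  obtain C where C: "\<And>f. f \<in> A \<Longrightarrow> bergman_norm p \<alpha> (T f) \<le> C * bergman_norm p \<alpha> f"
    using operator unfolding bounded_linear_operator_on_def by blast
  have "bergman_norm p \<alpha> (indicator U) \<le> C * bergman_norm p \<alpha> (disc_monom n)" for n
  proof -
    have "bergman_norm p \<alpha> (indicator U) \<le> bergman_norm p \<alpha> (T (disc_monom n))"
    proof (rule bergman_norm_mono)
      show "bergman_integral p \<alpha> (T (disc_monom n)) < \<infinity>"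
        using T_in[OF monom_in] by (simp add: bergman_space_def)
      show "cmod (indicator U z) \<le> cmod (T (disc_monom n) z)" if "z \<in> unit_disc" for z
        using ge[of z] by (cases "z \<in> U") (simp_all add: T_monom[OF that, of n] norm_power)
    qed (use p \<alpha> in auto)
    also have "\<dots> \<le> C * bergman_norm p \<alpha> (disc_monom n)"
      by (rule C[OF monom_in])
    finally show ?thesis .
  qed
  moreover have "(\<lambda>n. C * bergman_norm p \<alpha> (disc_monom n)) \<longlonglongrightarrow> C * 0"
    by (intro tendsto_intros bergman_norm_disc_monom_tendsto_0 p \<alpha>)
  ultimately have "bergman_norm p \<alpha> (indicator U) \<le> C * 0"
    by (intro LIMSEQ_le_const) auto
  then show False
    using bergman_norm_indicator_pos[OF U p \<alpha>] by simp
qed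

lemma symbol_less_1:
  assumes w: "w \<in> unit_disc"
  shows "cmod (\<phi> w) < 1"
proof (rule ccontr)
  assume *: "\<not> cmod (\<phi> w) < 1"
  show False
  \<comment> \<open>The open mapping theorem excludes constants; a constant of modulus at least 1
    contradicts the previous lemma on the whole disc.\<close>
  proof (cases "\<phi> constant_on unit_disc")
    case True
    then have "\<phi> z = \<phi> w" if "z \<in> unit_disc" for z
      using that w by (metis constant_on_def)
    then show False
      using * not_expanding_on_open[of unit_disc] by auto
  next
    case False
    let ?U = "{z \<in> unit_disc. 1 < cmod (\<phi> z)}"
    have cont: "continuous_on unit_disc \<phi>"
      using symbol_holomorphic by (rule holomorphic_on_imp_continuous_on)
    have "open (\<phi> ` unit_disc)"
      using symbol_holomorphic False by (intro open_mapping_thm[of _ unit_disc]) auto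
    then obtain r where r: "0 < r" "ball (\<phi> w) r \<subseteq> \<phi> ` unit_disc"
      using w by (meson image_eqI openE)
    \<comment> \<open>\<open>v\<close> is \<open>\<phi> w\<close> pushed radially outwards by
      \<open>r / 2\<close>: it stays in the ball of attained values and has modulus strictly above
      1. The strict inequality is what makes \<open>?U\<close> open.\<close>
    define v where "v = \<phi> w * of_real (1 + r / (2 * cmod (\<phi> w)))"
    have nz: "0 < cmod (\<phi> w)" using * by linarith
    have "v - \<phi> w = \<phi> w * of_real (r / (2 * cmod (\<phi> w)))"
      by (simp add: v_def algebra_simps)
    then have "cmod (v - \<phi> w) = r / 2"
      using nz r(1) by (simp add: norm_mult del: of_real_divide of_real_mult)
    then have "v \<in> ball (\<phi> w) r"
      using r(1) by (simp add: dist_norm norm_minus_commute)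
    then obtain u where u: "u \<in> unit_disc" "\<phi> u = v"
      using r(2) by blast
    have "cmod v = cmod (\<phi> w) * (1 + r / (2 * cmod (\<phi> w)))"
      unfolding v_def using nz r(1) by (simp add: norm_mult del: of_real_add of_real_divide of_real_mult)
    also have "\<dots> = cmod (\<phi> w) + r / 2"
      using nz by (simp add: field_simps)
    finally have "u \<in> ?U"
      using u * r(1) by auto
    moreover have "open ?U"
    proof -
      have "?U = unit_disc \<inter> (\<lambda>z. cmod (\<phi> z)) -` {1<..}" by auto
      then show ?thesis
        using continuous_open_preimage[OF continuous_on_norm[OF cont] open_ball, of "{1<..}"] by simp
    qed
    ultimately show False
      using not_expanding_on_open[of ?U] by fastforce
  qed
qed

lemma T_eq_compose:
  assumes f: "f \<in> A" and w: "w \<in> unit_disc"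
  shows "T f w = f (\<phi> w)"
proof -
  define a where "a = \<phi> w"
  have a: "a \<in> unit_disc" using symbol_less_1[OF w] by (simp add: a_def)
  obtain g where g: "g \<in> A" and fg: "\<And>z. z \<in> unit_disc \<Longrightarrow> f z = f a + (z - a) * g z"
    using bergman_space_factor[OF f p \<alpha> a] by blast
  \<comment> \<open>On the disc \<open>?l\<close> is \<open>z - a\<close> and \<open>?c\<close> is
    the constant \<open>f a\<close>, written through monomials on which \<open>T\<close> is
    known.\<close>
  let ?l = "\<lambda>z. disc_monom 1 z + (- a) * disc_monom 0 z"
  let ?c = "\<lambda>z. f a * disc_monom 0 z"
  have l: "?l \<in> A"
  proof (rule bergman_space_bounded[OF p \<alpha>])
    show "cmod (?l z) \<le> 1 + cmod a * 1" for z
      by (intro order_trans[OF norm_triangle_ineq] add_mono)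
        (auto simp: norm_mult norm_disc_monom_le intro!: mult_left_le)
    show "?l holomorphic_on unit_disc"
      by (intro holomorphic_intros disc_monom_holomorphic)
  qed (auto simp: disc_monom_def)
  \<comment> \<open>Almost multiplicativity applies only if the product lies in the space; here the
    product is \<open>f - f a\<close> on the disc.\<close>
  have lg: "(\<lambda>z. ?l z * g z) \<in> A"
  proof (rule bergman_space_dominated[OF f, of 1 "cmod (f a)"])
    show "cmod (?l z * g z) \<le> 1 * cmod (f z) + cmod (f a)" if "z \<in> unit_disc" for z
    proof -
      have "?l z * g z = f z - f a"
        using that fg[OF that] by (simp add: disc_monom_def algebra_simps)
      then show ?thesis using norm_triangle_ineq4[of "f z" "f a"] by simp
    qed
  qed (use p \<alpha> l g in \<open>auto simp: bergman_space_def intro: holomorphic_on_mult\<close>)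
  \<comment> \<open>All terms vanish outside the disc, so the factorization is an equality of
    functions and \<open>T\<close> may be applied to it.\<close>
  have "f = (\<lambda>z. ?c z + ?l z * g z)"
  proof
    fix z show "f z = ?c z + ?l z * g z"
      using fg[of z] f by (cases "z \<in> unit_disc") (auto simp: disc_monom_def bergman_space_def)
  qed
  then have "T f = T (\<lambda>z. ?c z + ?l z * g z)"
    by (rule arg_cong)
  also have "\<dots> = (\<lambda>z. T ?c z + T (\<lambda>z. ?l z * g z) z)"
    by (rule T_add[OF scale_in[OF monom_in] lg])
  finally have "T f w = f a * T (disc_monom 0) w + T ?l w * T g w"
    by (simp only: T_scale[OF monom_in] T_mult[OF l g lg])
  \<comment> \<open>By the choice of \<open>a\<close> this is 0, which removes the unknown value
    \<open>T g w\<close>.\<close>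
  also have "T ?l w = \<phi> w - a * T (disc_monom 0) w"
    using T_add[OF monom_in[of 1] scale_in[OF monom_in[of 0], of "- a"]]
    by (simp only: T_scale[OF monom_in]) simp
  finally have "T f w = f a"
    by (simp only: T_one[OF w] a_def[symmetric]) simp
  then show ?thesis
    by (simp only: a_def)
qed

lemma is_composition_operator: "composition_operator_on A T"
proof -
  have "\<phi> ` unit_disc \<subseteq> unit_disc"
    using symbol_less_1 by (simp add: image_subset_iff)
  then show ?thesis
    unfolding composition_operator_on_def
    by (intro exI[of _ \<phi>] conjI ballI symbol_holomorphic T_eq_compose)
qed

end

theorem theorem5p1:
  fixes p \<alpha> :: real
    and T :: "(complex \<Rightarrow> complex) \<Rightarrow> (complex \<Rightarrow> complex)"
  assumes "1 \<le> p" and "-1 < \<alpha>"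
    and "bounded_linear_operator_on (bergman_space p \<alpha>) (bergman_norm p \<alpha>) T"
    and "nonzero_operator_on (bergman_space p \<alpha>) T"
  shows "almost_multiplicative_on (bergman_space p \<alpha>) T
           \<longleftrightarrow> composition_operator_on (bergman_space p \<alpha>) T"
proof
  assume "almost_multiplicative_on (bergman_space p \<alpha>) T"
  then interpret bergman_multiplicative p \<alpha> T
    using assms by unfold_locales
  show "composition_operator_on (bergman_space p \<alpha>) T"
    by (rule is_composition_operator)
next
  assume "composition_operator_on (bergman_space p \<alpha>) T"
  then obtain \<phi> where T: "\<And>f z. f \<in> bergman_space p \<alpha> \<Longrightarrow> z \<in> unit_disc \<Longrightarrow> T f z = f (\<phi> z)"
    by (auto simp: composition_operator_on_def)
  \<comment> \<open>The symbol describes \<open>T f\<close> on the disc only. Outside it,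
    \<open>T f\<close> vanishes as a member of the space, and the product identity there reads
    \<open>0 = 0\<close>.\<close>
  have out: "T f z = 0" if "f \<in> bergman_space p \<alpha>" "z \<notin> unit_disc" for f z
    using assms(3) that by (auto simp: bounded_linear_operator_on_def bergman_space_def)
  show "almost_multiplicative_on (bergman_space p \<alpha>) T"
    unfolding almost_multiplicative_on_def
  proof (intro ballI impI ext)
    fix f g z
    assume fg: "f \<in> bergman_space p \<alpha>" "g \<in> bergman_space p \<alpha>" "(\<lambda>z. f z * g z) \<in> bergman_space p \<alpha>"
    show "T (\<lambda>z. f z * g z) z = T f z * T g z"
      using T[OF fg(1)] T[OF fg(2)] T[OF fg(3)] out[OF fg(1)] out[OF fg(3)]
      by (cases "z \<in> unit_disc") simp_all
  qed
qed

end
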